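(* Let $\mathbb{F}_q$ be any finite field, let $m:\mathbb{N}\to\mathbb{N}$ satisfy $m(n)-n\to\infty$ as $n\to\infty$, and let $A_n\sim[U_q]^{m(n)\times n}$. Then $M[A_n]$ is asymptotically almost surely the free matroid on $n$ elements, i.e. $$\lim_{n\to\infty}\mathbb{P}\{M[A_n]\text{ is the free matroid on } n \text{ elements}\}=1.$$
   Context: $\mathbb{F}_q$ is the finite field with $q$ elements. $[U_q]^{m\times n}$ denotes the uniform distribution on $\mathbb{F}_q^{m\times n}$ (entries i.i.d. uniform on $\mathbb{F}_q$), and $A \sim [U_q]^{m \times n}$ means that $A$ is drawn from it. For a matrix $A$ over $\mathbb{F}_q$ with $n$ columns, $M[A]$ is the column dependence matroid of $A$: its ground set is the set of column indices $\{1,\dots,n\}$, and a set of indices is independent iff the corresponding columns form a linearly independent family. A free matroid is a matroid in which every subset of the ground set is independent. *)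

theory Defs
  imports "HOL-Probability.Probability" "Jordan_Normal_Form.VS_Connect"
begin

record 'e indep_system =
  ground :: "'e set"
  indep :: "'e set \<Rightarrow> bool"

definition matroid :: "'e indep_system \<Rightarrow> bool" where
  "matroid M \<longleftrightarrow>
     finite (ground M) \<and>
     (\<forall>I. indep M I \<longrightarrow> I \<subseteq> ground M) \<and>
     indep M {} \<and>
     (\<forall>I J. indep M J \<and> I \<subseteq> J \<longrightarrow> indep M I) \<and>
     (\<forall>I J. indep M I \<and> indep M J \<and> card I < card J \<longrightarrow>
        (\<exists>x \<in> J - I. indep M (insert x I)))"

definition free_matroid :: "'e indep_system \<Rightarrow> bool" where
  "free_matroid M \<longleftrightarrow> matroid M \<and> (\<forall>I \<subseteq> ground M. indep M I)"

definition free_matroid_on :: "nat \<Rightarrow> 'e indep_system \<Rightarrow> bool" where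
  "free_matroid_on n M \<longleftrightarrow> free_matroid M \<and> card (ground M) = n"

text \<open>
  Column indices start at 0. Independence concerns the family of columns: the library predicate
  \<open>lin_indpt\<close> is about sets of vectors, so a repeated column has to be excluded by injectivity.
\<close>

definition column_matroid :: "'a::field mat \<Rightarrow> nat indep_system" where
  "column_matroid A =
     \<lparr> ground = {0..<dim_col A},
       indep = (\<lambda>I. I \<subseteq> {0..<dim_col A} \<and> inj_on (col A) I \<and>
         module.lin_indpt class_ring (module_vec TYPE('a) (dim_row A)) (col A ` I)) \<rparr>"

lemma matroid_column_matroid: "matroid (column_matroid (A :: 'a::field mat))"
proof -
  interpret vec_space "TYPE('a)" "dim_row A" .
  have sub: "col A ` I \<subseteq> carrier_vec (dim_row A)" for I
    by auto
  have augment: "\<exists>x \<in> J - I. inj_on (col A) (insert x I) \<and> lin_indpt (insert (col A x) (col A ` I))"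
    if I: "I \<subseteq> {0..<dim_col A}" "inj_on (col A) I" "lin_indpt (col A ` I)"
      and J: "J \<subseteq> {0..<dim_col A}" "inj_on (col A) J" "lin_indpt (col A ` J)"
      and less: "card I < card J" for I J
  proof (rule ccontr)
    assume contra: "\<not> ?thesis"
    have fin: "finite I" "finite J"
      using I(1) J(1) finite_subset by blast+
    have "col A x \<in> span (col A ` I)" if "x \<in> J" for x
    proof (cases "col A x \<in> col A ` I")
      case True
      then show ?thesis
        using span_mem sub by blast
    next
      case False
      then have "x \<in> J - I" "inj_on (col A) (insert x I)"
        using that I(2) by auto
      then have "lin_dep (insert (col A x) (col A ` I))"
        using contra by blast
      then show ?thesis
        using lin_dep_iff_in_span[OF sub I(3) _ False] by simp
    qed
    then obtain C :: "'a vec set"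
      where "int (card C) \<le> int (card (col A ` I)) - int (card (col A ` J))"
      using replacement[of "col A ` J" "col A ` I"] fin J(3) sub by blast
    then have "card (col A ` J) \<le> card (col A ` I)"
      by linarith
    then show False
      using less by (simp add: card_image I(2) J(2))
  qed
  have empty: "lin_indpt {}"
    by (simp add: lin_dep_def)
  have subset: "inj_on (col A) I \<and> lin_indpt (col A ` I)"
    if "I \<subseteq> J" "inj_on (col A) J" "lin_indpt (col A ` J)" for I J
    using that inj_on_subset subset_li_is_li[of "col A ` J" "col A ` I"] by blast
  have indep: "indep (column_matroid A) I \<longleftrightarrow>
      I \<subseteq> {0..<dim_col A} \<and> inj_on (col A) I \<and> lin_indpt (col A ` I)" for I
    by (simp add: column_matroid_def)
  have ground: "ground (column_matroid A) = {0..<dim_col A}"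
    by (simp add: column_matroid_def)
  show ?thesis
    unfolding matroid_def
  proof (intro conjI allI impI)
    show "indep (column_matroid A) I" if "indep (column_matroid A) J \<and> I \<subseteq> J" for I J
      using that subset[of I J] unfolding indep by blast
    show "\<exists>x \<in> J - I. indep (column_matroid A) (insert x I)"
      if IJ: "indep (column_matroid A) I \<and> indep (column_matroid A) J \<and> card I < card J" for I J
    proof -
      obtain x where "x \<in> J - I" "inj_on (col A) (insert x I)"
          "lin_indpt (insert (col A x) (col A ` I))"
        using IJ augment[of I J] unfolding indep by blast
      moreover have "insert x I \<subseteq> {0..<dim_col A}"
        using IJ \<open>x \<in> J - I\<close> unfolding indep by blast
      ultimately show ?thesis
        unfolding indep by (metis image_insert)
    qed
  qed (use empty in \<open>simp_all add: indep ground\<close>)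
qed

definition uniform_mat :: "nat \<Rightarrow> nat \<Rightarrow> 'a::{field,finite} mat pmf" where
  "uniform_mat m n = pmf_of_set (carrier_mat m n)"

lemma finite_carrier_mat: "finite (carrier_mat m n :: 'a::finite mat set)"
proof (rule finite_subset)
  let ?F = "({..<m} \<times> {..<n}) \<rightarrow>\<^sub>E (UNIV :: 'a set)"
  show "finite (mat m n ` ?F)"
    by (intro finite_imageI finite_PiE) auto
  show "carrier_mat m n \<subseteq> mat m n ` ?F"
  proof
    fix A :: "'a mat" assume A: "A \<in> carrier_mat m n"
    have "A = mat m n (restrict (\<lambda>ij. A $$ ij) ({..<m} \<times> {..<n}))"
      using A by (intro eq_matI) auto
    then show "A \<in> mat m n ` ?F"
      by auto
  qed
qed

lemma set_uniform_mat:
  "set_pmf (uniform_mat m n :: 'a::{field,finite} mat pmf) = carrier_mat m n"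
  using zero_carrier_mat unfolding uniform_mat_def
  by (intro set_pmf_of_set finite_carrier_mat) blast

end

theory Submission
  imports Defs "Jordan_Normal_Form.DL_Rank"
begin

text \<open>
  The column matroid of \<open>A\<close> fails to be free exactly when \<open>A *\<^sub>v v = 0\<close> for some nonzero \<open>v\<close>.
  For a fixed nonzero \<open>v\<close> this has probability at most \<open>1 / q ^ m\<close>: pick \<open>j\<close> with \<open>v\<^sub>j \<noteq> 0\<close>;
  adding an arbitrary vector \<open>w\<close> to column \<open>j\<close> of a solution \<open>A\<close> gives a matrix \<open>B\<close> with
  \<open>B *\<^sub>v v = v\<^sub>j w\<close>, so \<open>B\<close> determines \<open>w\<close> and \<open>A\<close>. The union bound over all \<open>v\<close> gives failure
  probability at most \<open>q ^ n / q ^ m\<close>.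
\<close>

lemma card_carrier_vec: "card (carrier_vec n :: 'a::finite vec set) = CARD('a) ^ n"
proof -
  have "bij_betw list_of_vec (carrier_vec n :: 'a vec set) {xs. set xs \<subseteq> UNIV \<and> length xs = n}"
    by (rule bij_betw_byWitness[where f' = vec_of_list])
       (auto simp: list_vec vec_list intro: carrier_vecI)
  from bij_betw_same_card[OF this] show ?thesis
    using card_lists_length_eq[of "UNIV :: 'a set" n] by simp
qed

lemma finite_carrier_vec: "finite (carrier_vec n :: 'a::finite vec set)"
  by (rule card_ge_0_finite) (simp add: card_carrier_vec)

text \<open>A repeated column or a linear dependence among distinct columns would each produce a
  nonzero kernel vector. So the full index set is independent, and downward closure gives all its
  subsets.\<close>

lemma free_matroid_on_column_matroidI:
  fixes A :: "'a::field mat"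
  assumes A: "A \<in> carrier_mat m n"
    and kernel: "\<And>v. v \<in> carrier_vec n \<Longrightarrow> A *\<^sub>v v = 0\<^sub>v m \<Longrightarrow> v = 0\<^sub>v n"
  shows "free_matroid_on n (column_matroid A)"
proof -
  interpret vec_space "TYPE('a)" m .
  have dims: "dim_row A = m" "dim_col A = n"
    using A by auto
  have mult_unit_vec: "A *\<^sub>v unit_vec n k = col A k" if "k < n" for k
    using A that by (intro eq_vecI) auto
  have inj: "inj_on (col A) {0..<n}"
  proof (rule inj_onI, rule ccontr)
    fix i j assume ij: "i \<in> {0..<n}" "j \<in> {0..<n}" "col A i = col A j" "i \<noteq> j"
    \<comment> \<open>Equal columns i and j put the difference of the two unit vectors into the
      kernel, yet its entry at i is 1.\<close>
    have "A *\<^sub>v (unit_vec n i - unit_vec n j) = A *\<^sub>v unit_vec n i - A *\<^sub>v unit_vec n j"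
      using A by (intro mult_minus_distrib_mat_vec) auto
    also have "\<dots> = col A i - col A j"
      using ij(1,2) by (simp add: mult_unit_vec)
    also have "\<dots> = 0\<^sub>v m"
      using A ij(2) unfolding ij(3) by (intro minus_cancel_vec col_carrier_vec) auto
    finally have "unit_vec n i - unit_vec n j = (0\<^sub>v n :: 'a vec)"
      by (intro kernel) simp_all
    then have "(unit_vec n i - unit_vec n j) $ i = (0 :: 'a)"
      using ij by simp
    then show False
      using ij by simp
  qed
  have cols: "cols A = map (col A) [0..<n]" "set (cols A) = col A ` {0..<n}"
    by (auto simp: cols_def dims)
  \<comment> \<open>Distinctness lets coefficients on the set of columns be read as the entries of a
    kernel vector, which \<open>lin_depE\<close> supplies.\<close>
  have "distinct (cols A)"
    using inj by (simp add: cols distinct_map)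
  then have "lin_indpt (set (cols A))"
    using kernel by (auto elim: lin_depE[OF A])
  then have "indep (column_matroid A) {0..<n}"
    using inj by (simp add: column_matroid_def dims cols)
  moreover have "ground (column_matroid A) = {0..<n}"
    by (simp add: column_matroid_def dims)
  moreover have "indep (column_matroid A) I" if "indep (column_matroid A) J" "I \<subseteq> J" for I J
    using matroid_column_matroid[of A] that unfolding matroid_def by blast
  ultimately show ?thesis
    using matroid_column_matroid[of A]
    by (auto simp: free_matroid_on_def free_matroid_def)
qed

lemma card_annihilating_mat_le:
  fixes v :: "'a::{field,finite} vec"
  assumes v: "v \<in> carrier_vec n" "v \<noteq> 0\<^sub>v n"
  shows "card {A \<in> carrier_mat m n. A *\<^sub>v v = 0\<^sub>v m} * CARD('a) ^ m
    \<le> card (carrier_mat m n :: 'a mat set)"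
proof -
  obtain j where j: "j < n" "v $ j \<noteq> 0"
    using v by (metis carrier_vecD eq_vecI index_zero_vec(1,2))
  \<comment> \<open>\<open>W w\<close> carries w in column j and zeros elsewhere, so adding it
    changes column j only.\<close>
  define W :: "'a vec \<Rightarrow> 'a mat"
    where "W w = mat m n (\<lambda>(i, k). if k = j then w $ i else 0)" for w
  have W: "W w \<in> carrier_mat m n" for w
    by (simp add: W_def)
  have W_mult: "W w *\<^sub>v v = v $ j \<cdot>\<^sub>v w" if "w \<in> carrier_vec m" for w
  proof (rule eq_vecI)
    fix i assume "i < dim_vec (v $ j \<cdot>\<^sub>v w)"
    then have i: "i < m" "i < dim_vec w"
      using that by auto
    have "(W w *\<^sub>v v) $ i = (\<Sum>k\<in>{0..<n}. (if k = j then w $ i else 0) * v $ k)"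
      using i v by (simp add: W_def scalar_prod_def)
    also have "\<dots> = (\<Sum>k\<in>{0..<n}. if k = j then w $ i * v $ k else 0)"
      by (rule sum.cong) auto
    finally show "(W w *\<^sub>v v) $ i = (v $ j \<cdot>\<^sub>v w) $ i"
      using i j by simp
  qed (use that in \<open>simp add: W_def\<close>)
  let ?Z = "{A \<in> carrier_mat m n. A *\<^sub>v v = 0\<^sub>v m}"
  have "inj_on (\<lambda>(A, w). A + W w) (?Z \<times> carrier_vec m)"
  proof (rule inj_onI, clarify)
    fix A B w u
    assume A: "A \<in> carrier_mat m n" "A *\<^sub>v v = 0\<^sub>v m"
      and B: "B \<in> carrier_mat m n" "B *\<^sub>v v = 0\<^sub>v m"
      and w: "w \<in> carrier_vec m" and u: "u \<in> carrier_vec m"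
      and eq: "A + W w = B + W u"
    \<comment> \<open>Applying the sum to v kills the summand A and isolates w up to the factor
      \<open>v $ j\<close>, which is nonzero and cancels.\<close>
    have "v $ j \<cdot>\<^sub>v w = (A + W w) *\<^sub>v v"
      using A w v(1) by (simp add: add_mult_distrib_mat_vec[OF _ W] W_mult)
    also have "\<dots> = v $ j \<cdot>\<^sub>v u"
      unfolding eq using B u v(1) by (simp add: add_mult_distrib_mat_vec[OF _ W] W_mult)
    finally have scaled: "v $ j \<cdot>\<^sub>v w = v $ j \<cdot>\<^sub>v u" .
    have "w = u"
    proof (rule eq_vecI)
      fix i assume "i < dim_vec u"
      then show "w $ i = u $ i"
        using arg_cong[OF scaled, of "\<lambda>x. x $ i"] w u j by simp
    qed (use w u in simp)
    moreover have "A = B"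
    proof (rule eq_matI)
      fix i k assume "i < dim_row B" "k < dim_col B"
      then show "A $$ (i, k) = B $$ (i, k)"
        using arg_cong[OF eq, of "\<lambda>X. X $$ (i, k)"] B W[of u] \<open>w = u\<close> by simp
    qed (use A B in simp_all)
    ultimately show "A = B \<and> w = u"
      by simp
  qed
  moreover have "(\<lambda>(A, w). A + W w) ` (?Z \<times> carrier_vec m) \<subseteq> carrier_mat m n"
    using W by (auto intro!: add_carrier_mat)
  ultimately have "card (?Z \<times> (carrier_vec m :: 'a vec set)) \<le> card (carrier_mat m n :: 'a mat set)"
    using finite_carrier_mat by (rule card_inj_on_le)
  then show ?thesis
    by (simp add: card_cartesian_product card_carrier_vec)
qed

lemma prob_annihilating_mat_le:
  fixes v :: "'a::{field,finite} vec"
  assumes "v \<in> carrier_vec n" "v \<noteq> 0\<^sub>v n"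
  shows "measure_pmf.prob (uniform_mat m n) {A. A *\<^sub>v v = 0\<^sub>v m} \<le> 1 / real CARD('a) ^ m"
proof -
  have ne: "(carrier_mat m n :: 'a mat set) \<noteq> {}"
    using zero_carrier_mat by blast
  then have pos: "card (carrier_mat m n :: 'a mat set) > 0"
    by (simp add: card_gt_0_iff finite_carrier_mat)
  have "real (card {A \<in> carrier_mat m n. A *\<^sub>v v = 0\<^sub>v m} * CARD('a) ^ m)
      \<le> real (card (carrier_mat m n :: 'a mat set))"
    using card_annihilating_mat_le[OF assms, of m] by (simp only: of_nat_le_iff)
  then show ?thesis
    using pos by (simp add: uniform_mat_def measure_pmf_of_set[OF ne finite_carrier_mat]
        Int_def field_simps)
qed

text \<open>Nonasymptotic form of the result, by a union bound over the nonzero vectors; it has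
  content only for m > n.\<close>

lemma prob_free_matroid_ge:
  "measure_pmf.prob (uniform_mat m n :: 'a::{field,finite} mat pmf)
     {A. free_matroid_on n (column_matroid A)} \<ge> 1 - real CARD('a) ^ n / real CARD('a) ^ m"
    (is "measure_pmf.prob ?p ?F \<ge> _")
proof -
  let ?V = "carrier_vec n - {0\<^sub>v n :: 'a vec}"
  have "1 - measure_pmf.prob ?p ?F = measure_pmf.prob ?p (- ?F)"
    using measure_pmf.prob_compl[of ?F ?p] by (simp add: Compl_eq_Diff_UNIV)
  also have "\<dots> \<le> measure_pmf.prob ?p (\<Union>v\<in>?V. {A. A *\<^sub>v v = 0\<^sub>v m})"
  \<comment> \<open>The inclusion of events is claimed only for matrices of shape m by n, that is,
    on the support of the distribution.\<close>
  proof (rule measure_pmf.finite_measure_mono_AE)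
    show "AE A in ?p. A \<in> - ?F \<longrightarrow> A \<in> (\<Union>v\<in>?V. {A. A *\<^sub>v v = 0\<^sub>v m})"
      unfolding AE_measure_pmf_iff set_uniform_mat
      using free_matroid_on_column_matroidI[of _ m n] by blast
  qed simp
  also have "\<dots> \<le> (\<Sum>v\<in>?V. measure_pmf.prob ?p {A. A *\<^sub>v v = 0\<^sub>v m})"
    by (rule measure_UNION_le) (auto simp: finite_carrier_vec)
  also have "\<dots> \<le> (\<Sum>v\<in>?V. 1 / real CARD('a) ^ m)"
    by (intro sum_mono prob_annihilating_mat_le) auto
  \<comment> \<open>Putting the zero vector back makes the number of terms exactly q ^ n.\<close>
  also have "\<dots> \<le> (\<Sum>v\<in>(carrier_vec n :: 'a vec set). 1 / real CARD('a) ^ m)"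
    by (intro sum_mono2) (auto simp: finite_carrier_vec)
  also have "\<dots> = real CARD('a) ^ n / real CARD('a) ^ m"
    by (simp add: card_carrier_vec)
  finally show ?thesis
    by simp
qed

theorem lemma3:
  fixes m :: "nat \<Rightarrow> nat"
  assumes "filterlim (\<lambda>n. int (m n) - int n) at_top sequentially"
  shows "(\<lambda>n. measure_pmf.prob (uniform_mat (m n) n :: 'a::{field,finite} mat pmf)
            {A. free_matroid_on n (column_matroid A)}) \<longlonglongrightarrow> 1"
proof -
  let ?q = "real CARD('a)"
  \<comment> \<open>A field has 0 and 1 distinct, so q is at least 2 and powers of 1 / q tend to
    0.\<close>
  have "card {0, 1 :: 'a} \<le> CARD('a)"
    by (rule card_mono) auto
  then have q: "?q > 1"
    by simp
  have "filterlim (\<lambda>n. nat (int (m n) - int n)) sequentially sequentially"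
    using filterlim_compose[OF filterlim_nat_sequentially assms] .
  then have "(\<lambda>n. (1 / ?q) ^ nat (int (m n) - int n)) \<longlonglongrightarrow> 0"
    using q by (intro filterlim_compose[OF LIMSEQ_realpow_zero]) auto
  \<comment> \<open>Where m n < n, \<open>nat\<close> truncates the exponent to 0 and the equation
    fails; this happens for only finitely many n.\<close>
  moreover have "eventually (\<lambda>n. (1 / ?q) ^ nat (int (m n) - int n) = ?q ^ n / ?q ^ m n) sequentially"
    using eventually_compose_filterlim[OF eventually_ge_at_top[of 0] assms]
  proof eventually_elim
    case (elim n)
    then have "nat (int (m n) - int n) = m n - n" "n \<le> m n"
      by auto
    then show ?case
      using q by (simp add: power_diff power_divide)
  qed
  ultimately have "(\<lambda>n. ?q ^ n / ?q ^ m n) \<longlonglongrightarrow> 0"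
    by (rule Lim_transform_eventually)
  then have "(\<lambda>n. 1 - ?q ^ n / ?q ^ m n) \<longlonglongrightarrow> 1 - 0"
    by (intro tendsto_diff tendsto_const)
  then have lower: "(\<lambda>n. 1 - ?q ^ n / ?q ^ m n) \<longlonglongrightarrow> 1"
    by simp
  show ?thesis
    by (rule tendsto_sandwich[OF _ _ lower tendsto_const])
       (simp_all add: prob_free_matroid_ge)
qed

end
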